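(* Let $F$ be a probability distribution function on $\mathbb{R}$, let $\overline F(x)=1-F(x)$, let $X_1,X_2,\dots$ be independent random variables each with distribution $F$, and let $S_n=\sum_{i=1}^n X_i$. Then $F$ belongs to the subexponential class $\mathcal{S}$ if and only if $$\lim_{t\to\infty}\frac{\overline F(t+x)}{\overline F(t)}=1\quad\text{for each real }x$$ and there exists a sequence $\{t_n\}$ of positive constants such that $$\limsup_{n\to\infty}\ \sup_{s\ge t_n}\frac{P[S_n>s]}{n\overline F(s)}\le 1 .$$ Moreover, when $F\in\mathcal{S}$ there exists a sequence $\{t_n\}$ of positive constants such that $$\lim_{n\to\infty}\ \sup_{s\ge t_n}\left|\frac{P[S_n>s]}{n\overline F(s)}-1\right|=0 .$$
   Context: The subexponential class $\mathcal{S}$ consists of those probability distributions $F$ on $\mathbb{R}$ (not necessarily supported on $[0,\infty)$) satisfying both of the following, where $\overline F=1-F$ and $X_1,X_2$ are independent with distribution $F$: (1) $\lim_{t\to\infty} P[X_1+X_2>t]/\overline F(t)$ exists and is finite; (2) $\lim_{t\to\infty}\overline F(t+x)/\overline F(t)=1$ for each real $x$. (It is implicit that $\overline F(t)>0$ for all $t$.) *)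

theory Defs
  imports "HOL-Probability.Probability"
begin

definition tail :: "real measure \<Rightarrow> real \<Rightarrow> real" where
  "tail F t = 1 - cdf F t"

text \<open>Distributions are Borel probability measures on the whole real line. The independent pair
  with common law \<open>F\<close> is realised by the coordinates of the product space, and the limit
  \<open>L\<close> is a real number, hence finite.\<close>

definition subexponential :: "real measure \<Rightarrow> bool" where
  "subexponential F \<longleftrightarrow>
     real_distribution F \<and>
     (\<forall>t. tail F t > 0) \<and>
     (\<exists>L::real. ((\<lambda>t. \<P>(x in F \<Otimes>\<^sub>M F. fst x + snd x > t) / tail F t) \<longlongrightarrow> L) at_top) \<and>
     (\<forall>x. ((\<lambda>t. tail F (t + x) / tail F t) \<longlongrightarrow> 1) at_top)"

end

theory Submission imports Defs begin

text \<open>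
  Everything rests on the pair: for a long-tailed \<open>F\<close>, membership in the class is equivalent to
  \<open>limsup P[X\<^sub>1 + X\<^sub>2 > t] / tail F t \<le> 2\<close>.

  That an existing limit \<open>L\<close> cannot exceed \<open>2\<close> is seen with the submultiplicative test function
  \<open>g x = r ^ min (max 0 \<lceil>x\<rceil>) N\<close>, \<open>r > 1\<close>. Put \<open>m = E g(X\<^sub>1)\<close>. If \<open>L > 2 + \<delta>\<close>, then summation by parts
  gives \<open>m\<^sup>2 - 1 \<ge> E g(X\<^sub>1 + X\<^sub>2) - 1 \<ge> (2 + \<delta>) (m - 1) - o(1)\<close> as \<open>r \<rightarrow> 1\<close>. Long tails make
  \<open>m\<close> unbounded in \<open>N\<close>, so \<open>N\<close> can be chosen to put \<open>m\<close> just above \<open>1 + \<delta> / 2\<close>, which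
  contradicts this inequality.

  Given the bound \<open>2\<close>, splitting \<open>X + Y > t\<close> according to which summand exceeds a large constant
  \<open>K\<close> gives \<open>P[S\<^sub>n > t] \<sim> n tail F t\<close> for every fixed \<open>n\<close>, and then \<open>t\<^sub>n\<close> is chosen for each \<open>n\<close>.

  Conversely, if \<open>P[X\<^sub>1 + X\<^sub>2 > s] > (2 + \<delta>) tail F s\<close> for arbitrarily large \<open>s\<close>, then, since one large
  pair among \<open>m\<close> independent pairs suffices, \<open>P[S\<^bsub>2m\<^esub> > s]\<close> exceeds about
  \<open>m (2 + \<delta>) tail F s\<close> for such \<open>s\<close>, for every \<open>m\<close>. This is incompatible with the limsup condition.
\<close>

section \<open>Long tails and convolution\<close>

definition long_tailed :: "real measure \<Rightarrow> bool" where
  "long_tailed F \<longleftrightarrow> (\<forall>x. ((\<lambda>t. tail F (t + x) / tail F t) \<longlongrightarrow> 1) at_top)"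

context real_distribution
begin

lemma tail_eq_measure: "tail M t = measure M {t<..}"
proof -
  have "{t<..} = space M - {..t}" by auto
  moreover have "prob (space M - {..t}) = 1 - prob {..t}" by (rule prob_compl) simp
  ultimately show ?thesis by (simp only: tail_def cdf_def)
qed

lemma tail_nonneg: "0 \<le> tail M t"
  by (simp add: tail_eq_measure)

lemma tail_antimono: "s \<le> t \<Longrightarrow> tail M t \<le> tail M s"
  unfolding tail_eq_measure by (intro finite_measure_mono) auto

lemma tail_tendsto_0: "(tail M \<longlongrightarrow> 0) at_top"
  using tendsto_diff[OF tendsto_const[of 1] cdf_lim_at_top_prob] by (simp add: tail_def[abs_def])

lemma tail_measurable[measurable]: "tail M \<in> borel_measurable borel"
  unfolding tail_def[abs_def]
  by (intro borel_measurable_diff borel_measurable_const borel_measurable_mono monoI cdf_nondecreasing)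

text \<open>A zero of the tail would persist by monotonicity. Since division by zero gives 0, the
  quotient would then be eventually 0 instead of tending to 1.\<close>

lemma long_tailed_pos:
  assumes "long_tailed M"
  shows "tail M t > 0"
proof (rule ccontr)
  assume "\<not> ?thesis"
  then have z: "tail M s = 0" if "s \<ge> t" for s
    using tail_nonneg[of s] tail_antimono[OF that] by linarith
  have "((\<lambda>s. tail M (s + 0) / tail M s) \<longlongrightarrow> 1) at_top"
    using assms by (simp only: long_tailed_def)
  moreover have "eventually (\<lambda>s. tail M (s + 0) / tail M s = 0) at_top"
    using eventually_ge_at_top[of t] by eventually_elim (simp add: z)
  then have "((\<lambda>s. tail M (s + 0) / tail M s) \<longlongrightarrow> 0) at_top"
    by (rule tendsto_eventually)
  ultimately have "1 = (0::real)"
    by (rule tendsto_unique[OF trivial_limit_at_top_linorder])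
  then show False by simp
qed

end

section \<open>Pairs of distributions on the line and the tail of their convolution\<close>

lemma sets_borel_pair_Collect:
  fixes Q :: "real \<times> real \<Rightarrow> bool"
  assumes "Measurable.pred (borel \<Otimes>\<^sub>M borel) Q"
  shows "Collect Q \<in> sets (borel \<Otimes>\<^sub>M borel)"
  using assms by (simp add: pred_def space_pair_measure)

locale real_distribution_pair = G: real_distribution G + H: real_distribution H
  for G H :: "real measure"

sublocale real_distribution_pair \<subseteq> pair_prob_space G H ..

context real_distribution_pair
begin

lemma space_pair: "space (G \<Otimes>\<^sub>M H) = UNIV"
  by (simp add: space_pair_measure)

lemma sets_pair[measurable_cong]: "sets (G \<Otimes>\<^sub>M H) = sets (borel \<Otimes>\<^sub>M borel)"
  by (intro sets_pair_measure_cong) simp_all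

lemma measure_fibers:
  assumes Q: "Q \<in> sets (borel \<Otimes>\<^sub>M borel)"
  shows "measure (G \<Otimes>\<^sub>M H) Q = (\<integral>x. measure H (Pair x -` Q) \<partial>G)"
    and "(\<lambda>x. measure H (Pair x -` Q)) \<in> borel_measurable borel"
proof -
  have Q': "Q \<in> sets (G \<Otimes>\<^sub>M H)" using Q sets_pair by simp
  have m: "(\<lambda>x. measure H (Pair x -` Q)) \<in> borel_measurable G"
    using H.measurable_emeasure_Pair[OF Q'] unfolding measure_def by measurable
  then show "(\<lambda>x. measure H (Pair x -` Q)) \<in> borel_measurable borel" by simp
  have "emeasure (G \<Otimes>\<^sub>M H) Q = (\<integral>\<^sup>+x. ennreal (measure H (Pair x -` Q)) \<partial>G)"
    by (simp add: H.emeasure_pair_measure_alt[OF Q'] H.emeasure_eq_measure)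
  also have "\<dots> = ennreal (\<integral>x. measure H (Pair x -` Q) \<partial>G)"
    using m by (intro nn_integral_eq_integral G.integrable_const_bound[where B=1]) auto
  finally show "measure (G \<Otimes>\<^sub>M H) Q = (\<integral>x. measure H (Pair x -` Q) \<partial>G)"
    by (simp add: measure_def integral_nonneg)
qed

lemma measure_rectangle:
  assumes "A \<in> sets borel" "B \<in> sets borel"
  shows "measure (G \<Otimes>\<^sub>M H) (A \<times> B) = measure G A * measure H B"
  using H.emeasure_pair_measure_Times[of A G B] assms
  by (simp add: measure_def enn2real_mult)

lemma convolution_eq: "G \<star> H = distr (G \<Otimes>\<^sub>M H) borel (\<lambda>p. fst p + snd p)"
  by (simp add: convolution_def case_prod_beta')

lemma real_distribution_convolution: "real_distribution (G \<star> H)"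
  unfolding convolution_eq by (intro real_distribution_distr) measurable

lemma tail_convolution:
  "tail (G \<star> H) t = measure (G \<Otimes>\<^sub>M H) {p. fst p + snd p > t}"
proof -
  interpret C: real_distribution "G \<star> H" by (rule real_distribution_convolution)
  have "tail (G \<star> H) t = measure (distr (G \<Otimes>\<^sub>M H) borel (\<lambda>p. fst p + snd p)) {t<..}"
    by (simp only: C.tail_eq_measure) (simp only: convolution_eq)
  then show ?thesis
    by (simp add: measure_distr space_pair vimage_def)
qed

text \<open>Two summands that are both at most \<open>K\<close> cannot add up to more than
  \<open>t \<ge> 2 * K\<close>, so the first two events are disjoint; the third is what they leave
  over.\<close>

lemma tail_convolution_split:
  assumes "2 * K \<le> t"
  shows "tail (G \<star> H) t = measure (G \<Otimes>\<^sub>M H) {p. fst p \<le> K \<and> fst p + snd p > t}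
    + measure (G \<Otimes>\<^sub>M H) {p. snd p \<le> K \<and> fst p + snd p > t}
    + measure (G \<Otimes>\<^sub>M H) {p. fst p > K \<and> snd p > K \<and> fst p + snd p > t}"
proof -
  let ?A = "{p::real\<times>real. fst p \<le> K \<and> fst p + snd p > t}"
  let ?B = "{p::real\<times>real. snd p \<le> K \<and> fst p + snd p > t}"
  let ?C = "{p::real\<times>real. fst p > K \<and> snd p > K \<and> fst p + snd p > t}"
  have [measurable]: "?A \<in> sets (G \<Otimes>\<^sub>M H)" "?B \<in> sets (G \<Otimes>\<^sub>M H)" "?C \<in> sets (G \<Otimes>\<^sub>M H)"
    unfolding sets_pair by (auto intro!: sets_borel_pair_Collect)
  have "{p::real\<times>real. fst p + snd p > t} = (?A \<union> ?B) \<union> ?C" by auto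
  then have "tail (G \<star> H) t = measure (G \<Otimes>\<^sub>M H) ((?A \<union> ?B) \<union> ?C)"
    by (simp only: tail_convolution)
  also have "\<dots> = measure (G \<Otimes>\<^sub>M H) (?A \<union> ?B) + measure (G \<Otimes>\<^sub>M H) ?C"
    by (rule P.finite_measure_Union) (measurable, auto)
  also have "measure (G \<Otimes>\<^sub>M H) (?A \<union> ?B) = measure (G \<Otimes>\<^sub>M H) ?A + measure (G \<Otimes>\<^sub>M H) ?B"
    using assms by (intro P.finite_measure_Union) (measurable, auto)
  finally show ?thesis .
qed

lemma measure_swap:
  assumes "Q \<in> sets (borel \<Otimes>\<^sub>M borel)"
  shows "measure (G \<Otimes>\<^sub>M H) Q = measure (H \<Otimes>\<^sub>M G) {p. (snd p, fst p) \<in> Q}"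
proof -
  have Q: "Q \<in> sets (G \<Otimes>\<^sub>M H)" using assms sets_pair by simp
  show ?thesis
    by (subst distr_pair_swap, subst measure_distr[OF measurable_pair_swap' Q])
       (auto simp: vimage_def space_pair_measure case_prod_beta)
qed

end

lemma real_distribution_pairI:
  "real_distribution G \<Longrightarrow> real_distribution H \<Longrightarrow> real_distribution_pair G H"
  by (simp add: real_distribution_pair_def)

section \<open>Tail asymptotics of a convolution\<close>

text \<open>Integrating over the first coordinate leaves \<open>tail H (t - x) / tail F t\<close> on
  \<open>x \<le> K\<close>. This tends to \<open>c\<close> for each \<open>x\<close> by the long
  tails of \<open>F\<close>, and dominated convergence applies.\<close>

lemma left_small_asymp:
  assumes "real_distribution F" "real_distribution G" "real_distribution H"
    and lt: "long_tailed F"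
    and lim: "((\<lambda>t. tail H t / tail F t) \<longlongrightarrow> c) at_top"
  shows "((\<lambda>t. measure (G \<Otimes>\<^sub>M H) {p. fst p \<le> K \<and> fst p + snd p > t} / tail F t)
      \<longlongrightarrow> c * measure G {..K}) at_top"
proof -
  interpret F: real_distribution F by fact
  interpret real_distribution_pair G H using assms by (simp add: real_distribution_pairI)
  let ?f = "\<lambda>t x. indicator {..K} x * (tail H (t - x) / tail F t)"
  have pos: "tail F t > 0" for t using F.long_tailed_pos[OF lt] .
  have ptw: "((\<lambda>t. tail H (t - x) / tail F t) \<longlongrightarrow> c) at_top" for x
  proof -
    have "filterlim (\<lambda>t::real. t - x) at_top at_top"
      using filterlim_tendsto_add_at_top[OF tendsto_const[of "-x"] filterlim_ident] by simp
    then have "((\<lambda>t. tail H (t - x) / tail F (t - x)) \<longlongrightarrow> c) at_top"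
      using lim filterlim_compose by blast
    moreover have "((\<lambda>t. tail F (t + - x) / tail F t) \<longlongrightarrow> 1) at_top"
      using lt unfolding long_tailed_def by blast
    ultimately have "((\<lambda>t. tail H (t - x) / tail F (t - x) * (tail F (t + - x) / tail F t)) \<longlongrightarrow> c * 1) at_top"
      by (rule tendsto_mult)
    moreover have "(\<lambda>t. tail H (t - x) / tail F (t - x) * (tail F (t + - x) / tail F t))
        = (\<lambda>t. tail H (t - x) / tail F t)"
      using pos by (auto simp: less_imp_neq[THEN not_sym])
    ultimately show ?thesis by simp
  qed
  have eq: "measure (G \<Otimes>\<^sub>M H) {p. fst p \<le> K \<and> fst p + snd p > t} / tail F t = (\<integral>x. ?f t x \<partial>G)" for t
  proof -
    have "Pair x -` {p. fst p \<le> K \<and> fst p + snd p > t} = (if x \<le> K then {t - x<..} else {})" for x :: real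
      by auto
    then have "(\<lambda>x. measure H (Pair x -` {p. fst p \<le> K \<and> fst p + snd p > t}) / tail F t) = ?f t"
      by (auto simp: fun_eq_iff H.tail_eq_measure)
    moreover have "{p::real\<times>real. fst p \<le> K \<and> fst p + snd p > t} \<in> sets (borel \<Otimes>\<^sub>M borel)"
      by (intro sets_borel_pair_Collect) measurable
    ultimately show ?thesis
      by (simp only: measure_fibers(1) flip: integral_divide_zero)
  qed
  have "((\<lambda>t. \<integral>x. ?f t x \<partial>G) \<longlongrightarrow> (\<integral>x. indicator {..K} x * c \<partial>G)) at_top"
  proof (rule integral_dominated_convergence_at_top)
    show "integrable G (\<lambda>x. c + 1 :: real)" by simp
    \<comment> \<open>The tail of \<open>H\<close> is monotone, so the eventual bound at
      \<open>x = K\<close> dominates the integrand for all \<open>x \<le> K\<close>.\<close>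
    have "\<forall>\<^sub>F t in at_top. tail H (t - K) / tail F t < c + 1"
      using ptw[of K] by (rule order_tendstoD) simp
    then show "\<forall>\<^sub>F t in at_top. AE x in G. norm (?f t x) \<le> c + 1"
    proof eventually_elim
      fix t assume t: "tail H (t - K) / tail F t < c + 1"
      have "norm (?f t x) \<le> c + 1" for x
      proof (cases "x \<le> K")
        case True
        have "tail H (t - x) / tail F t \<le> tail H (t - K) / tail F t"
          using True pos[of t] by (intro divide_right_mono H.tail_antimono) auto
        then show ?thesis using t True pos[of t] H.tail_nonneg[of "t - x"] by simp
      next
        case False
        have "0 \<le> tail H (t - K) / tail F t" using pos[of t] H.tail_nonneg[of "t - K"] by simp
        with False t show ?thesis by simp
      qed
      then show "AE x in G. norm (?f t x) \<le> c + 1" by simp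
    qed
    show "AE x in G. ((\<lambda>t. ?f t x) \<longlongrightarrow> indicator {..K} x * c) at_top"
      using ptw by (intro AE_I2 tendsto_mult tendsto_const)
  qed (measurable)
  then show ?thesis unfolding eq by (simp add: mult.commute)
qed

text \<open>The fiber over \<open>x > K\<close> is the ray beyond \<open>max K (t - x)\<close>, and
  there \<open>M\<close> controls the tail of \<open>H\<close>. Thus a general \<open>H\<close> is
  traded for a second copy of \<open>F\<close> at the price of the factor \<open>M\<close>.\<close>

lemma measure_both_large_le:
  assumes "real_distribution F" "real_distribution H"
    and M: "\<And>u. K \<le> u \<Longrightarrow> tail H u \<le> M * tail F u"
  shows "measure (F \<Otimes>\<^sub>M H) {p. fst p > K \<and> snd p > K \<and> fst p + snd p > t}
    \<le> M * measure (F \<Otimes>\<^sub>M F) {p. fst p > K \<and> snd p > K \<and> fst p + snd p > t}"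
proof -
  interpret F: real_distribution F by fact
  interpret H: real_distribution H by fact
  interpret FH: real_distribution_pair F H using assms by (simp add: real_distribution_pairI)
  interpret FF: real_distribution_pair F F using assms by (simp add: real_distribution_pairI)
  let ?R = "{p::real\<times>real. fst p > K \<and> snd p > K \<and> fst p + snd p > t}"
  have R: "?R \<in> sets (borel \<Otimes>\<^sub>M borel)"
    by (intro sets_borel_pair_Collect) measurable
  have fiber: "Pair x -` ?R = (if x > K then {max K (t - x)<..} else {})" for x
    by auto
  have "measure (F \<Otimes>\<^sub>M H) ?R = (\<integral>x. measure H (Pair x -` ?R) \<partial>F)"
    by (rule FH.measure_fibers[OF R])
  also have "\<dots> \<le> (\<integral>x. M * measure F (Pair x -` ?R) \<partial>F)"
  proof (rule integral_mono)
    show "integrable F (\<lambda>x. measure H (Pair x -` ?R))"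
      using FH.measure_fibers(2)[OF R] by (intro F.integrable_const_bound[where B=1]) auto
    show "integrable F (\<lambda>x. M * measure F (Pair x -` ?R))"
      using FF.measure_fibers(2)[OF R]
      by (intro integrable_mult_right F.integrable_const_bound[where B=1]) auto
    show "measure H (Pair x -` ?R) \<le> M * measure F (Pair x -` ?R)" for x
      unfolding fiber using M[of "max K (t - x)"] by (simp add: H.tail_eq_measure F.tail_eq_measure)
  qed
  also have "\<dots> = M * measure (F \<Otimes>\<^sub>M F) ?R"
    by (simp only: integral_mult_right_zero FF.measure_fibers(1)[OF R])
  finally show ?thesis .
qed

text \<open>This is the induction step for convolution powers. The two events with one summand at
  most \<open>K\<close> contribute a limit that approaches \<open>1 + c\<close> as \<open>K\<close>
  grows. Where both summands exceed \<open>K\<close>, \<open>H\<close> is replaced by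
  \<open>F\<close> at a bounded cost, and for \<open>F \<star> F\<close> the bound
  \<open>two\<close> leaves little there, since the other two events already use up almost
  2.\<close>

lemma tail_convolution_asymp:
  assumes "real_distribution F" "real_distribution H"
    and lt: "long_tailed F"
    and two: "\<And>\<delta>. \<delta> > 0 \<Longrightarrow> \<forall>\<^sub>F t in at_top. tail (F \<star> F) t \<le> (2 + \<delta>) * tail F t"
    and lim: "((\<lambda>t. tail H t / tail F t) \<longlongrightarrow> c) at_top"
  shows "((\<lambda>t. tail (F \<star> H) t / tail F t) \<longlongrightarrow> 1 + c) at_top"
proof -
  interpret F: real_distribution F by fact
  interpret H: real_distribution H by fact
  interpret FH: real_distribution_pair F H using assms by (simp add: real_distribution_pairI)
  interpret FF: real_distribution_pair F F using assms by (simp add: real_distribution_pairI)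
  have pos: "tail F t > 0" for t using F.long_tailed_pos[OF lt] .
  then have ne: "tail F t \<noteq> 0" for t by (simp add: less_imp_neq[THEN not_sym])
  let ?R = "\<lambda>K t. {p::real\<times>real. fst p > K \<and> snd p > K \<and> fst p + snd p > t}"
  let ?A = "\<lambda>K t. {p::real\<times>real. fst p \<le> K \<and> fst p + snd p > t}"
  let ?B = "\<lambda>K t. {p::real\<times>real. snd p \<le> K \<and> fst p + snd p > t}"
  have B: "?B K t \<in> sets (borel \<Otimes>\<^sub>M borel)" for K t
    by (intro sets_borel_pair_Collect) measurable
  have swap: "{p. (snd p, fst p) \<in> ?B K t} = ?A K t" for K t by (auto simp: add.commute)
  have refl_lim: "((\<lambda>t. tail F t / tail F t) \<longlongrightarrow> 1) at_top" using ne by simp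
  define near where "near K t = (measure (F \<Otimes>\<^sub>M H) (?A K t) + measure (F \<Otimes>\<^sub>M H) (?B K t)) / tail F t" for K t
  have near: "((\<lambda>t. near K t) \<longlongrightarrow> c * cdf F K + 1 * cdf H K) at_top" for K
    unfolding near_def add_divide_distrib FH.measure_swap[OF B] swap cdf_def
    by (intro tendsto_add left_small_asymp assms refl_lim)
  have near_lim: "((\<lambda>K. c * cdf F K + 1 * cdf H K) \<longlongrightarrow> c * 1 + 1 * 1) at_top"
    by (intro tendsto_intros F.cdf_lim_at_top_prob H.cdf_lim_at_top_prob)
  have split: "tail (F \<star> H) t / tail F t = near K t + measure (F \<Otimes>\<^sub>M H) (?R K t) / tail F t"
    if "2 * K \<le> t" for K t
    unfolding FH.tail_convolution_split[OF that] near_def by (simp add: add_divide_distrib)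
  show ?thesis
  proof (rule order_tendstoI)
    fix u assume "u < 1 + c"
    then have "\<forall>\<^sub>F K in at_top. u < c * cdf F K + 1 * cdf H K"
      by (intro order_tendstoD(1)[OF near_lim]) simp
    then obtain K where "u < c * cdf F K + 1 * cdf H K"
      using eventually_happens'[OF trivial_limit_at_top_linorder] by blast
    then have "\<forall>\<^sub>F t in at_top. u < near K t"
      by (rule order_tendstoD(1)[OF near])
    then show "\<forall>\<^sub>F t in at_top. u < tail (F \<star> H) t / tail F t"
      using eventually_ge_at_top[of "2 * K"]
    proof eventually_elim
      fix t assume t: "u < near K t" "2 * K \<le> t"
      have "0 \<le> measure (F \<Otimes>\<^sub>M H) (?R K t) / tail F t" using pos[of t] by simp
      with t show "u < tail (F \<star> H) t / tail F t" by (simp add: split)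
    qed
  next
    fix u assume u: "1 + c < u"
    define M where "M = \<bar>c\<bar> + 1"
    have "M > 0" by (simp add: M_def)
    \<comment> \<open>The excess \<open>\<delta>\<close> is multiplied by \<open>M\<close> below, so
      it is chosen to use up half of the gap between \<open>1 + c\<close> and
      \<open>u\<close>.\<close>
    define \<delta> where "\<delta> = (u - 1 - c) / (2 * M)"
    have "\<delta> > 0" using u \<open>M > 0\<close> by (simp add: \<delta>_def)
    have M\<delta>: "M * \<delta> = (u - 1 - c) / 2" using \<open>M > 0\<close> by (simp add: \<delta>_def)
    have "\<forall>\<^sub>F t in at_top. tail H t / tail F t < M"
      by (intro order_tendstoD(2)[OF lim]) (simp add: M_def)
    then obtain K0 where K0: "\<And>t. t \<ge> K0 \<Longrightarrow> tail H t / tail F t < M"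
      by (auto simp: eventually_at_top_linorder)
    have "((\<lambda>K. c * cdf F K + 1 * cdf H K + M * (2 + \<delta> - (1 * cdf F K + 1 * cdf F K)))
        \<longlongrightarrow> c * 1 + 1 * 1 + M * (2 + \<delta> - (1 * 1 + 1 * 1))) at_top"
      by (intro tendsto_intros F.cdf_lim_at_top_prob H.cdf_lim_at_top_prob)
    moreover have "c * 1 + 1 * 1 + M * (2 + \<delta> - (1 * 1 + 1 * 1)) < u"
      using u M\<delta> by simp
    ultimately have "\<forall>\<^sub>F K in at_top. c * cdf F K + 1 * cdf H K + M * (2 + \<delta> - (1 * cdf F K + 1 * cdf F K)) < u"
      by (rule order_tendstoD)
    then have "\<forall>\<^sub>F K in at_top. K \<ge> K0 \<and> c * cdf F K + 1 * cdf H K + M * (2 + \<delta> - (1 * cdf F K + 1 * cdf F K)) < u"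
      using eventually_ge_at_top[of K0] by eventually_elim simp
    then obtain K where K: "K \<ge> K0" "c * cdf F K + 1 * cdf H K + M * (2 + \<delta> - (1 * cdf F K + 1 * cdf F K)) < u"
      using eventually_happens'[OF trivial_limit_at_top_linorder] by blast
    define nearF where "nearF t = (measure (F \<Otimes>\<^sub>M F) (?A K t) + measure (F \<Otimes>\<^sub>M F) (?B K t)) / tail F t" for t
    have nearF: "(nearF \<longlongrightarrow> 1 * cdf F K + 1 * cdf F K) at_top"
      unfolding nearF_def[abs_def] add_divide_distrib FF.measure_swap[OF B] swap cdf_def
      by (intro tendsto_add left_small_asymp assms refl_lim)
    have "((\<lambda>t. near K t + M * (2 + \<delta> - nearF t))
        \<longlongrightarrow> c * cdf F K + 1 * cdf H K + M * (2 + \<delta> - (1 * cdf F K + 1 * cdf F K))) at_top"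
      by (intro tendsto_intros near nearF)
    then have "\<forall>\<^sub>F t in at_top. near K t + M * (2 + \<delta> - nearF t) < u"
      using K(2) by (rule order_tendstoD)
    then show "\<forall>\<^sub>F t in at_top. tail (F \<star> H) t / tail F t < u"
      using two[OF \<open>\<delta> > 0\<close>] eventually_ge_at_top[of "2 * K"]
    proof eventually_elim
      fix t assume t: "near K t + M * (2 + \<delta> - nearF t) < u"
        "tail (F \<star> F) t \<le> (2 + \<delta>) * tail F t" "2 * K \<le> t"
      have "tail (F \<star> F) t / tail F t \<le> 2 + \<delta>"
        using t(2) pos[of t] by (simp add: pos_divide_le_eq)
      then have far: "measure (F \<Otimes>\<^sub>M F) (?R K t) / tail F t \<le> 2 + \<delta> - nearF t"
        unfolding FF.tail_convolution_split[OF t(3)] nearF_def by (simp add: add_divide_distrib)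
      have "tail H s \<le> M * tail F s" if "K \<le> s" for s
        using K0[of s] K(1) that pos[of s] by (simp add: pos_divide_less_eq)
      then have "measure (F \<Otimes>\<^sub>M H) (?R K t) \<le> M * measure (F \<Otimes>\<^sub>M F) (?R K t)"
        by (intro measure_both_large_le assms)
      then have "measure (F \<Otimes>\<^sub>M H) (?R K t) / tail F t \<le> M * (measure (F \<Otimes>\<^sub>M F) (?R K t) / tail F t)"
        using pos[of t] by (simp add: divide_right_mono less_imp_le)
      also have "\<dots> \<le> M * (2 + \<delta> - nearF t)"
        using far \<open>M > 0\<close> by (intro mult_left_mono) auto
      finally show "tail (F \<star> H) t / tail F t < u"
        using t(1) by (simp add: split[OF t(3)])
    qed
  qed
qed

section \<open>The limit for two summands is at most 2\<close>

text \<open>Telescoping of \<open>r ^ Suc k - r ^ k = (r - 1) * r ^ k\<close> over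
  \<open>k < min n N\<close>.\<close>

lemma min_power_eq_sum:
  fixes r :: "'a::comm_ring_1"
  shows "r ^ min n N = 1 + (\<Sum>k<N. (r - 1) * r ^ k * of_bool (k < n))"
proof (induction N)
  case (Suc N)
  have "r ^ min n (Suc N) = r ^ min n N + (r - 1) * r ^ N * of_bool (N < n)"
    by (cases "N < n") (simp_all add: min_absorb1 min_absorb2 algebra_simps)
  then show ?case by (simp add: Suc)
qed simp

text \<open>Rounding up keeps \<open>capped_exp\<close> submultiplicative and turns its expectation into a finite sum of tails.\<close>

definition capped_exp :: "real \<Rightarrow> nat \<Rightarrow> real \<Rightarrow> real" where
  "capped_exp r N x = r ^ min (nat \<lceil>x\<rceil>) N"

lemma capped_exp_measurable[measurable]: "capped_exp r N \<in> borel_measurable borel"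
  unfolding capped_exp_def[abs_def] by measurable

lemma capped_exp_ge_1: "r \<ge> 1 \<Longrightarrow> capped_exp r N x \<ge> 1"
  by (simp add: capped_exp_def)

lemma capped_exp_le: "r \<ge> 1 \<Longrightarrow> capped_exp r N x \<le> r ^ N"
  by (simp add: capped_exp_def power_increasing)

text \<open>Limits how far the expectation can jump when the cap rises by one, so that the first cap
  past a threshold overshoots only slightly.\<close>

lemma capped_exp_Suc: "r \<ge> 1 \<Longrightarrow> capped_exp r (Suc N) x \<le> r * capped_exp r N x"
  unfolding capped_exp_def power_Suc[symmetric] by (intro power_increasing) auto

text \<open>The ceiling is subadditive, and truncation at 0 and at \<open>N\<close> preserves this
  for the exponent.\<close>

lemma capped_exp_submult:
  assumes "r \<ge> 1"
  shows "capped_exp r N (x + y) \<le> capped_exp r N x * capped_exp r N y"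
proof -
  have "\<lceil>x + y\<rceil> \<le> \<lceil>x\<rceil> + \<lceil>y\<rceil>" by (rule ceiling_add_le)
  then have "min (nat \<lceil>x + y\<rceil>) N \<le> min (nat \<lceil>x\<rceil>) N + min (nat \<lceil>y\<rceil>) N" by linarith
  then show ?thesis unfolding capped_exp_def power_add[symmetric]
    using assms by (rule power_increasing)
qed

lemma capped_exp_eq_sum:
  "capped_exp r N x = 1 + (\<Sum>k<N. (r - 1) * r ^ k * indicator {real k<..} x)"
proof -
  have "k < nat \<lceil>x\<rceil> \<longleftrightarrow> real k < x" for k by linarith
  then show ?thesis
    unfolding capped_exp_def min_power_eq_sum by (simp add: indicator_def of_bool_def)
qed

context real_distribution
begin

lemma integrable_capped_exp: "r \<ge> 1 \<Longrightarrow> integrable M (capped_exp r N)"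
  using capped_exp_le[of r N] order_trans[OF zero_le_one capped_exp_ge_1[of r N]]
  by (intro integrable_const_bound[where B="r ^ N"]) auto

lemma expectation_capped_exp:
  "(\<integral>x. capped_exp r N x \<partial>M) = 1 + (\<Sum>k<N. (r - 1) * r ^ k * tail M (real k))"
proof -
  have "(\<integral>x. capped_exp r N x \<partial>M)
      = (\<integral>x. 1 + (\<Sum>k<N. (r - 1) * r ^ k * indicator {real k<..} x) \<partial>M)"
    by (simp only: capped_exp_eq_sum)
  also have "\<dots> = 1 + (\<Sum>k<N. (r - 1) * r ^ k * measure M {real k<..})"
  proof -
    have int: "integrable M (\<lambda>x. (r - 1) * r ^ k * indicator {real k<..} x)" for k
      by (intro integrable_mult_right integrable_real_indicator) (auto simp: less_top[symmetric])
    show ?thesis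
      using prob_space
      by (subst Bochner_Integration.integral_add, simp, intro Bochner_Integration.integrable_sum int,
          subst Bochner_Integration.integral_sum[OF int]) simp
  qed
  finally show ?thesis by (simp add: tail_eq_measure)
qed

text \<open>Long tails decay more slowly than any geometric sequence: from some \<open>k0\<close>
  on, \<open>r ^ k * tail M (real k)\<close> does not decrease, so the sum for the expectation has
  terms bounded below by a positive constant.\<close>

lemma expectation_capped_exp_unbounded:
  assumes lt: "long_tailed M" and r: "r > 1"
  shows "\<exists>N. B < (\<integral>x. capped_exp r N x \<partial>M)"
proof -
  have pos: "tail M t > 0" for t using long_tailed_pos[OF lt] .
  have "((\<lambda>t. tail M (t + 1) / tail M t) \<longlongrightarrow> 1) at_top"
    using lt by (simp only: long_tailed_def)
  then have "\<forall>\<^sub>F t in at_top. 1 / r < tail M (t + 1) / tail M t"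
    using r by (intro order_tendstoD(1)) auto
  then obtain T where T: "\<And>t. t \<ge> T \<Longrightarrow> 1 / r < tail M (t + 1) / tail M t"
    by (auto simp: eventually_at_top_linorder)
  obtain k0 where k0: "T \<le> real k0" using real_arch_simple by blast
  define c where "c = r ^ k0 * tail M (real k0)"
  have "c > 0" using r pos by (simp add: c_def)
  have step: "r ^ k * tail M (real k) \<le> r ^ Suc k * tail M (real (Suc k))" if "k \<ge> k0" for k
  proof -
    have "T \<le> real k" using that k0 by linarith
    from T[OF this] have "tail M (real k) \<le> r * tail M (real k + 1)"
      using pos[of "real k"] r by (simp add: field_simps)
    then show ?thesis using r by (simp add: add.commute mult.assoc mult.left_commute[of _ r])
  qed
  have ge: "c \<le> r ^ (k0 + j) * tail M (real (k0 + j))" for j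
  proof (induction j)
    case (Suc j)
    then show ?case using step[of "k0 + j"] by (simp only: add_Suc_right) linarith
  qed (simp add: c_def)
  have lower: "1 + real j * ((r - 1) * c) \<le> (\<integral>x. capped_exp r (k0 + j) x \<partial>M)" for j
  proof (induction j)
    case 0
    show ?case unfolding expectation_capped_exp using r
      by (auto intro!: sum_nonneg mult_nonneg_nonneg simp: tail_nonneg)
  next
    case (Suc j)
    have "(r - 1) * c \<le> (r - 1) * (r ^ (k0 + j) * tail M (real (k0 + j)))"
      using ge[of j] r by (intro mult_left_mono) auto
    with Suc show ?case unfolding expectation_capped_exp by (simp add: algebra_simps)
  qed
  have "(r - 1) * c > 0" using r \<open>c > 0\<close> by simp
  then obtain j where "B < real j * ((r - 1) * c)" using reals_Archimedean3 by blast
  then have "B < (\<integral>x. capped_exp r (k0 + j) x \<partial>M)" using lower[of j] by linarith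
  then show ?thesis by blast
qed

end

lemma (in real_distribution_pair) expectation_capped_exp_convolution:
  assumes r: "r \<ge> 1"
  shows "(\<integral>x. capped_exp r N x \<partial>(G \<star> H)) \<le> (\<integral>x. capped_exp r N x \<partial>G) * (\<integral>x. capped_exp r N x \<partial>H)"
proof -
  let ?g = "capped_exp r N"
  have nn: "0 \<le> ?g x" for x using capped_exp_ge_1[OF r, of N x] by linarith
  have b: "?g x * ?g y \<le> r ^ N * r ^ N" for x y
    using r nn by (intro mult_mono capped_exp_le) auto
  have int: "integrable (G \<Otimes>\<^sub>M H) (\<lambda>p. ?g (fst p) * ?g (snd p))"
    using b nn by (intro P.integrable_const_bound[where B="r ^ N * r ^ N"]) auto
  have "(\<integral>x. ?g x \<partial>(G \<star> H)) = (\<integral>p. ?g (fst p + snd p) \<partial>(G \<Otimes>\<^sub>M H))"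
    unfolding convolution_eq by (rule integral_distr) measurable
  also have "\<dots> \<le> (\<integral>p. ?g (fst p) * ?g (snd p) \<partial>(G \<Otimes>\<^sub>M H))"
  proof (rule integral_mono[OF _ int])
    show "integrable (G \<Otimes>\<^sub>M H) (\<lambda>p. ?g (fst p + snd p))"
      using capped_exp_le[OF r] nn by (intro P.integrable_const_bound[where B="r ^ N"]) auto
  qed (rule capped_exp_submult[OF r])
  also have "\<dots> = (\<integral>x. (\<integral>y. ?g x * ?g y \<partial>H) \<partial>G)"
    using integral_fst'[OF int] by simp
  also have "\<dots> = (\<integral>x. ?g x \<partial>G) * (\<integral>x. ?g x \<partial>H)"
    by simp
  finally show ?thesis .
qed

text \<open>If \<open>L > 2\<close>, the expectation \<open>m\<close> of the test function satisfies
  \<open>(m - 1) * (1 + \<delta> - m) < \<delta>\<^sup>2 / 8\<close>. Placing \<open>m\<close>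
  between \<open>1 + \<delta> / 2\<close> and \<open>1 + 3 * \<delta> / 4\<close> makes the factors
  at least \<open>\<delta> / 2\<close> and \<open>\<delta> / 4\<close>, a contradiction.\<close>

lemma long_tailed_convolution_limit_le_2:
  assumes "real_distribution F" and lt: "long_tailed F"
    and lim: "((\<lambda>t. tail (F \<star> F) t / tail F t) \<longlongrightarrow> L) at_top"
  shows "L \<le> 2"
proof (rule ccontr)
  assume "\<not> L \<le> 2"
  define \<delta> where "\<delta> = (L - 2) / 2"
  have \<delta>: "\<delta> > 0" "2 + \<delta> < L" using \<open>\<not> L \<le> 2\<close> by (auto simp: \<delta>_def field_simps)
  interpret F: real_distribution F by fact
  interpret FF: real_distribution_pair F F using assms by (simp add: real_distribution_pairI)
  interpret C: real_distribution "F \<star> F" by (rule FF.real_distribution_convolution)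
  have pos: "tail F t > 0" for t using F.long_tailed_pos[OF lt] .
  have "\<forall>\<^sub>F t in at_top. 2 + \<delta> < tail (F \<star> F) t / tail F t"
    using lim \<delta>(2) by (rule order_tendstoD)
  then obtain T' where T': "\<And>t. t \<ge> T' \<Longrightarrow> 2 + \<delta> < tail (F \<star> F) t / tail F t"
    by (auto simp: eventually_at_top_linorder)
  obtain T :: nat where T: "T' \<le> real T" using real_arch_simple by blast
  \<comment> \<open>For \<open>k < T\<close> nothing is known about the quotient. Subtracting 1 from
    a tail that is at most 1 makes the left side nonpositive, so that one inequality covers all
    \<open>k\<close>.\<close>
  have big: "(2 + \<delta>) * (tail F (real k) - of_bool (k < T)) \<le> tail (F \<star> F) (real k)" for k
  proof (cases "k < T")
    case True
    have "(2 + \<delta>) * (tail F (real k) - 1) \<le> 0"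
      using \<delta> by (intro mult_nonneg_nonpos) (auto simp: F.tail_eq_measure)
    then show ?thesis using True C.tail_nonneg[of "real k"] by simp
  next
    case False
    then have "2 + \<delta> < tail (F \<star> F) k / tail F k" using T by (intro T') linarith
    then show ?thesis using False pos[of k] by (simp add: pos_less_divide_eq)
  qed
  \<comment> \<open>\<open>T\<close> is already fixed, so taking \<open>r\<close> close to 1 makes
    small both the correction for \<open>k < T\<close> and the overshoot of one step in
    \<open>N\<close>.\<close>
  have "((\<lambda>r::real. (2 + \<delta>) * (r ^ T - 1)) \<longlongrightarrow> (2 + \<delta>) * (1 ^ T - 1)) (at_right 1)"
    and "((\<lambda>r::real. r * (1 + \<delta> / 2)) \<longlongrightarrow> 1 * (1 + \<delta> / 2)) (at_right 1)"
    by (intro tendsto_intros)+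
  from order_tendstoD(2)[OF this(1), of "\<delta>\<^sup>2 / 8"] order_tendstoD(2)[OF this(2), of "1 + 3 * \<delta> / 4"]
  have "\<forall>\<^sub>F r in at_right (1::real). (2 + \<delta>) * (r ^ T - 1) < \<delta>\<^sup>2 / 8"
    and "\<forall>\<^sub>F r in at_right (1::real). r * (1 + \<delta> / 2) < 1 + 3 * \<delta> / 4"
    using \<delta> by simp_all
  then have "\<forall>\<^sub>F r in at_right (1::real). r > 1 \<and> (2 + \<delta>) * (r ^ T - 1) < \<delta>\<^sup>2 / 8
      \<and> r * (1 + \<delta> / 2) < 1 + 3 * \<delta> / 4"
    using eventually_at_right_less[of 1] by eventually_elim simp
  then obtain r :: real where r: "r > 1" "(2 + \<delta>) * (r ^ T - 1) < \<delta>\<^sup>2 / 8" "r * (1 + \<delta> / 2) < 1 + 3 * \<delta> / 4"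
    using eventually_happens'[OF trivial_limit_at_right_real] by blast
  define m where "m N = (\<integral>x. capped_exp r N x \<partial>F)" for N
  have m_eq: "m N = 1 + (\<Sum>k<N. (r - 1) * r ^ k * tail F (real k))" for N
    unfolding m_def by (rule F.expectation_capped_exp)
  have m_Suc: "m (Suc N) \<le> r * m N" for N
  proof -
    have "m (Suc N) \<le> (\<integral>x. r * capped_exp r N x \<partial>F)"
      unfolding m_def using r by (intro integral_mono integrable_mult_right F.integrable_capped_exp capped_exp_Suc) auto
    then show ?thesis by (simp add: m_def)
  qed
  \<comment> \<open>The least such \<open>N\<close> is positive since \<open>m 0 = 1\<close>. Its
    predecessor stays at or below the threshold, and one step costs at most a factor
    \<open>r\<close>.\<close>
  define N where "N = (LEAST N. 1 + \<delta> / 2 < m N)"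
  have mN: "1 + \<delta> / 2 < m N"
    unfolding N_def by (rule LeastI_ex) (unfold m_def, rule F.expectation_capped_exp_unbounded[OF lt r(1)])
  moreover have "m 0 = 1" by (simp add: m_eq)
  ultimately have "N \<noteq> 0" using \<delta> by (intro notI) simp
  then obtain N' where N': "N = Suc N'" by (cases N) auto
  then have "m N' \<le> 1 + \<delta> / 2"
    using not_less_Least[of N' "\<lambda>N. 1 + \<delta> / 2 < m N"] unfolding N_def by simp
  then have "r * m N' \<le> r * (1 + \<delta> / 2)" using r by simp
  with m_Suc[of N'] r(3) have mN_le: "m N < 1 + 3 * \<delta> / 4" unfolding N' by linarith
  \<comment> \<open>The weighted terms \<open>of_bool (k < T)\<close> sum to
    \<open>r ^ min T N - 1\<close> by the telescoping identity.\<close>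
  have "(2 + \<delta>) * (m N - 1) - (2 + \<delta>) * (r ^ min T N - 1)
      = (\<Sum>k<N. (r - 1) * r ^ k * ((2 + \<delta>) * (tail F (real k) - of_bool (k < T))))"
    unfolding m_eq min_power_eq_sum
    by (simp add: sum_distrib_left right_diff_distrib sum_subtractf mult_ac)
  also have "\<dots> \<le> (\<Sum>k<N. (r - 1) * r ^ k * tail (F \<star> F) (real k))"
    using r big by (intro sum_mono mult_left_mono) auto
  also have "\<dots> = (\<integral>x. capped_exp r N x \<partial>(F \<star> F)) - 1"
    by (simp add: C.expectation_capped_exp)
  also have "\<dots> \<le> m N * m N - 1"
    using FF.expectation_capped_exp_convolution[of r N] r by (simp add: m_def)
  finally have 1: "(2 + \<delta>) * (m N - 1) - (2 + \<delta>) * (r ^ min T N - 1) \<le> m N * m N - 1" .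
  have "(2 + \<delta>) * (r ^ min T N - 1) \<le> (2 + \<delta>) * (r ^ T - 1)"
    using r \<delta> by (intro mult_left_mono diff_right_mono power_increasing) auto
  with 1 r(2) have 2: "(m N - 1) * (1 + \<delta> - m N) < \<delta>\<^sup>2 / 8"
    by (simp add: algebra_simps)
  have "\<delta> / 2 * (\<delta> / 4) \<le> (m N - 1) * (1 + \<delta> - m N)"
    using mN mN_le \<delta> by (intro mult_mono) auto
  with 2 show False by (simp add: power2_eq_square)
qed

section \<open>Lower bounds for convolution powers\<close>

text \<open>The filter restricts \<open>s\<close> to the arguments where a pair has a large tail; \<open>K\<close> absorbs the
  possibly negative contribution of the remaining summands.\<close>

definition tail_bound_up_to_shift :: "real measure \<Rightarrow> real filter \<Rightarrow> real measure \<Rightarrow> real \<Rightarrow> bool" where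
  "tail_bound_up_to_shift F \<F> H a \<longleftrightarrow>
     (\<forall>e>0. \<exists>K\<ge>0. \<forall>\<^sub>F s in \<F>. (a - e) * tail F s \<le> tail H (s - K))"

lemma (in real_distribution) tail_tendsto_1: "((\<lambda>K. tail M (- K)) \<longlongrightarrow> 1) at_top"
proof -
  have "((\<lambda>K. 1 - cdf M (- K)) \<longlongrightarrow> 1 - 0) at_top"
    by (intro tendsto_diff tendsto_const filterlim_compose[OF cdf_lim_at_bot filterlim_uminus_at_bot_at_top])
  then show ?thesis by (simp add: tail_def)
qed

text \<open>Two disjoint ways for the sum to be large: the first summand exceeds \<open>s\<close>
  and the second exceeds \<open>- L\<close>, or the first lies in \<open>{- L<..s}\<close> and the
  second exceeds \<open>s - K\<close>.\<close>

lemma (in real_distribution_pair) tail_convolution_ge: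
  assumes "0 \<le> K" "0 \<le> L" "- L \<le> s"
  shows "tail G s * tail H (- L) + (tail G (- L) - tail G s) * tail H (s - K) \<le> tail (G \<star> H) (s - K - L)"
proof -
  let ?A = "{s<..} \<times> {- L<..}" and ?B = "{- L<..s} \<times> {s - K<..}"
  let ?C = "{p::real\<times>real. fst p + snd p > s - K - L}"
  have C: "?C \<in> sets (G \<Otimes>\<^sub>M H)"
    unfolding sets_pair by (intro sets_borel_pair_Collect) measurable
  have [measurable]: "?A \<in> sets (G \<Otimes>\<^sub>M H)" "?B \<in> sets (G \<Otimes>\<^sub>M H)"
    by measurable
  have "measure G {- L<..s} = tail G (- L) - tail G s"
    using assms G.cdf_diff_eq[of "- L" s] by (cases "- L = s") (auto simp: tail_def)
  then have "tail G s * tail H (- L) + (tail G (- L) - tail G s) * tail H (s - K)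
      = measure (G \<Otimes>\<^sub>M H) ?A + measure (G \<Otimes>\<^sub>M H) ?B"
    by (simp add: measure_rectangle G.tail_eq_measure H.tail_eq_measure)
  also have "\<dots> = measure (G \<Otimes>\<^sub>M H) (?A \<union> ?B)"
    by (intro P.finite_measure_Union[symmetric]) (measurable, auto)
  also have "\<dots> \<le> measure (G \<Otimes>\<^sub>M H) ?C"
    using assms C by (intro P.finite_measure_mono) auto
  finally show ?thesis by (simp add: tail_convolution)
qed

text \<open>The constants add because either factor can supply the large value, while the other one
  exceeds \<open>- L\<close> with probability near 1. The price is the larger shift
  \<open>K + L\<close>.\<close>

lemma tail_bound_up_to_shift_convolution:
  assumes "real_distribution F" "real_distribution G" "real_distribution H"
    and top: "\<F> \<le> at_top"
    and G: "\<forall>\<^sub>F s in \<F>. b * tail F s \<le> tail G s"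
    and H: "tail_bound_up_to_shift F \<F> H a"
    and nn: "0 \<le> a" "0 \<le> b"
  shows "tail_bound_up_to_shift F \<F> (G \<star> H) (b + a)"
  unfolding tail_bound_up_to_shift_def
proof (intro allI impI)
  fix e :: real assume e: "e > 0"
  interpret F: real_distribution F by fact
  interpret G: real_distribution G by fact
  interpret H: real_distribution H by fact
  interpret real_distribution_pair G H using assms by (simp add: real_distribution_pairI)
  obtain K where K: "K \<ge> 0" "\<forall>\<^sub>F s in \<F>. (a - e / 2) * tail F s \<le> tail H (s - K)"
    using H e unfolding tail_bound_up_to_shift_def by (elim allE[where x="e / 2"]) auto
  \<comment> \<open>Half of \<open>e\<close> was spent on the bound for \<open>H\<close>; this
    \<open>\<eta>\<close> keeps the loss \<open>\<eta> * (a + b)\<close> within the other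
    half.\<close>
  define \<eta> where "\<eta> = (e / 2) / (a + b + e)"
  have "0 < a + b + e" using e nn by simp
  then have \<eta>_eq: "\<eta> * (a + b + e) = e / 2"
    using nonzero_divide_eq_eq[of "a + b + e" "e / 2" \<eta>] \<eta>_def by simp
  have \<eta>0: "\<eta> > 0" using e \<open>0 < a + b + e\<close> by (simp add: \<eta>_def)
  have "\<eta> \<le> 1" using e nn \<open>0 < a + b + e\<close> by (simp add: \<eta>_def divide_le_eq)
  moreover have "\<eta> * (a + b) \<le> e / 2"
    using \<eta>_eq mult_pos_pos[OF \<eta>0 e] by (simp add: distrib_left)
  ultimately have \<eta>: "\<eta> > 0" "\<eta> \<le> 1" "\<eta> * (a + b) \<le> e / 2" using \<eta>0 by auto
  \<comment> \<open>For \<open>G\<close> only \<open>\<eta> / 2\<close> may be lost here, since the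
    other \<open>\<eta> / 2\<close> is reserved for subtracting \<open>tail G s\<close>.\<close>
  have "\<forall>\<^sub>F L in at_top. L \<ge> 0 \<and> 1 - \<eta> < tail H (- L) \<and> 1 - \<eta> / 2 < tail G (- L)"
    using \<eta> by (intro eventually_conj eventually_ge_at_top order_tendstoD(1)[OF H.tail_tendsto_1]
      order_tendstoD(1)[OF G.tail_tendsto_1]) auto
  then obtain L where L: "L \<ge> 0" "1 - \<eta> < tail H (- L)" "1 - \<eta> / 2 < tail G (- L)"
    using eventually_happens'[OF trivial_limit_at_top_linorder] by blast
  have "\<forall>\<^sub>F s in at_top. tail G s < \<eta> / 2 \<and> - L \<le> s"
    using \<eta> by (intro eventually_conj eventually_ge_at_top order_tendstoD(2)[OF G.tail_tendsto_0]) auto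
  then have "\<forall>\<^sub>F s in \<F>. tail G s < \<eta> / 2 \<and> - L \<le> s"
    by (rule filter_leD[OF top])
  with G K(2) have "\<forall>\<^sub>F s in \<F>. (b + a - e) * tail F s \<le> tail (G \<star> H) (s - (K + L))"
  proof eventually_elim
    fix s assume s: "b * tail F s \<le> tail G s" "(a - e / 2) * tail F s \<le> tail H (s - K)" "tail G s < \<eta> / 2 \<and> - L \<le> s"
    have "(b + a - e) * tail F s \<le> (b + (a - e / 2)) * (1 - \<eta>) * tail F s"
    proof (intro mult_right_mono F.tail_nonneg)
      have "(b + (a - e / 2)) * (1 - \<eta>) = b + a - e / 2 - \<eta> * (a + b) + \<eta> * e / 2"
        by (simp add: field_simps)
      then show "b + a - e \<le> (b + (a - e / 2)) * (1 - \<eta>)"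
        using \<eta>(3) mult_pos_pos[OF \<eta>(1) e] by linarith
    qed
    also have "\<dots> = (b * tail F s) * (1 - \<eta>) + (1 - \<eta>) * ((a - e / 2) * tail F s)"
      by (simp add: algebra_simps)
    also have "\<dots> \<le> tail G s * (1 - \<eta>) + (1 - \<eta>) * tail H (s - K)"
      using s \<eta> by (intro add_mono mult_right_mono mult_left_mono) auto
    also have "\<dots> \<le> tail G s * tail H (- L) + (tail G (- L) - tail G s) * tail H (s - K)"
      using s L by (intro add_mono mult_right_mono mult_left_mono G.tail_nonneg H.tail_nonneg) auto
    also have "\<dots> \<le> tail (G \<star> H) (s - K - L)"
      using s K L by (intro tail_convolution_ge) auto
    finally show "(b + a - e) * tail F s \<le> tail (G \<star> H) (s - (K + L))"
      by (simp add: diff_diff_eq)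
  qed
  then show "\<exists>K\<ge>0. \<forall>\<^sub>F s in \<F>. (b + a - e) * tail F s \<le> tail (G \<star> H) (s - K)"
    using K(1) L(1) by (intro exI[of _ "K + L"]) auto
qed

section \<open>Convolution powers as laws of partial sums\<close>

fun conv_power :: "real measure \<Rightarrow> nat \<Rightarrow> real measure" where
  "conv_power F 0 = return borel 0"
| "conv_power F (Suc n) = (F \<star> conv_power F n)"

lemma real_distribution_conv_power:
  assumes "real_distribution F"
  shows "real_distribution (conv_power F n)"
proof (induction n)
  case 0
  interpret prob_space "return borel (0::real)" by (rule prob_space_return) simp
  show ?case
    by (simp add: real_distribution_def real_distribution_axioms_def prob_space_axioms)
next
  case (Suc n)
  then interpret real_distribution_pair F "conv_power F n" using assms by (simp add: real_distribution_pairI)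
  show ?case by (simp add: real_distribution_convolution)
qed

text \<open>Carries the statement about partial sums over to convolution powers:
  \<open>X (Suc n)\<close> is independent of the sum over the earlier indices.\<close>

lemma distr_sum_eq_conv_power:
  fixes X :: "nat \<Rightarrow> 'a \<Rightarrow> real"
  assumes "prob_space P" and "prob_space.indep_vars P (\<lambda>_. borel) X {1..}"
    and X: "\<And>i. i \<ge> 1 \<Longrightarrow> distr P borel (X i) = F"
  shows "distr P borel (\<lambda>\<omega>. \<Sum>i=1..n. X i \<omega>) = conv_power F n"
proof (induction n)
  interpret prob_space P by fact
  case 0
  show ?case by simp
next
  interpret prob_space P by fact
  have rv: "random_variable borel (X i)" if "i \<ge> 1" for i
    using assms(2) that by (auto simp: indep_vars_def)
  case (Suc n)
  have "indep_var borel (X (Suc n)) borel (\<lambda>\<omega>. \<Sum>i=1..n. X i \<omega>)"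
    by (intro indep_vars_sum indep_vars_subset[OF assms(2)]) auto
  then have "distr P borel (\<lambda>\<omega>. X (Suc n) \<omega> + (\<Sum>i=1..n. X i \<omega>))
      = (distr P borel (X (Suc n)) \<star> distr P borel (\<lambda>\<omega>. \<Sum>i=1..n. X i \<omega>))"
    by (intro sum_indep_random_variable rv borel_measurable_sum) auto
  also have "(\<lambda>\<omega>. X (Suc n) \<omega> + (\<Sum>i=1..n. X i \<omega>)) = (\<lambda>\<omega>. \<Sum>i=1..Suc n. X i \<omega>)"
    by (simp add: add.commute)
  also have "distr P borel (X (Suc n)) = F" by (rule X) simp
  finally show ?case by (simp only: Suc conv_power.simps)
qed

text \<open>Induction through \<open>tail_convolution_asymp\<close> with \<open>c = real n\<close>.
  The start is the point mass at 0, whose tail vanishes for \<open>t \<ge> 0\<close>.\<close>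

lemma tail_conv_power_asymp:
  assumes "real_distribution F" "long_tailed F"
    and "\<And>\<delta>. \<delta> > 0 \<Longrightarrow> \<forall>\<^sub>F t in at_top. tail (F \<star> F) t \<le> (2 + \<delta>) * tail F t"
  shows "((\<lambda>t. tail (conv_power F n) t / tail F t) \<longlongrightarrow> real n) at_top"
proof (induction n)
  case 0
  interpret Z: real_distribution "conv_power F 0" using assms by (intro real_distribution_conv_power)
  have "tail (conv_power F 0) t = 0" if "t \<ge> 0" for t
    using that by (simp add: Z.tail_eq_measure[simplified] measure_return)
  then have "\<forall>\<^sub>F t in at_top. tail (conv_power F 0) t / tail F t = 0"
    by (intro eventually_at_top_linorderI[of 0]) auto
  then show ?case by (simp add: tendsto_eventually)
next
  case (Suc n)
  from tail_convolution_asymp[OF assms(1) real_distribution_conv_power[OF assms(1)] assms(2,3) Suc]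
  show ?case by simp
qed

section \<open>Subexponentiality and tail bounds for convolution powers\<close>

text \<open>An existing limit is at most 2, which gives the bound. Conversely the upper bound yields
  the limit 2, since \<open>tail_convolution_asymp\<close> with \<open>H = F\<close> and
  \<open>c = 1\<close> provides the matching lower estimate.\<close>

lemma long_tailed_subexponential_iff:
  assumes "real_distribution F" "long_tailed F"
  shows "subexponential F \<longleftrightarrow> (\<forall>\<delta>>0. \<forall>\<^sub>F t in at_top. tail (F \<star> F) t \<le> (2 + \<delta>) * tail F t)"
proof -
  interpret F: real_distribution F by fact
  interpret FF: real_distribution_pair F F using assms by (simp add: real_distribution_pairI)
  have pos: "tail F t > 0" for t using F.long_tailed_pos[OF assms(2)] .
  have "subexponential F \<longleftrightarrow> (\<exists>L. ((\<lambda>t. tail (F \<star> F) t / tail F t) \<longlongrightarrow> L) at_top)"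
    using assms pos unfolding subexponential_def long_tailed_def
    by (simp add: FF.tail_convolution FF.space_pair)
  also have "\<dots> \<longleftrightarrow> (\<forall>\<delta>>0. \<forall>\<^sub>F t in at_top. tail (F \<star> F) t \<le> (2 + \<delta>) * tail F t)"
  proof safe
    fix L \<delta> :: real assume L: "((\<lambda>t. tail (F \<star> F) t / tail F t) \<longlongrightarrow> L) at_top" and "\<delta> > 0"
    then have "L < 2 + \<delta>" using long_tailed_convolution_limit_le_2[OF assms L] by simp
    with L have "\<forall>\<^sub>F t in at_top. tail (F \<star> F) t / tail F t < 2 + \<delta>" by (rule order_tendstoD)
    then show "\<forall>\<^sub>F t in at_top. tail (F \<star> F) t \<le> (2 + \<delta>) * tail F t"
      by eventually_elim (use pos in \<open>simp add: pos_divide_less_eq\<close>)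
  next
    assume "\<forall>\<delta>>0. \<forall>\<^sub>F t in at_top. tail (F \<star> F) t \<le> (2 + \<delta>) * tail F t"
    moreover have "((\<lambda>t. tail F t / tail F t) \<longlongrightarrow> 1) at_top"
      using pos by (simp add: less_imp_neq[THEN not_sym])
    ultimately have "((\<lambda>t. tail (F \<star> F) t / tail F t) \<longlongrightarrow> 1 + 1) at_top"
      using assms by (intro tail_convolution_asymp) auto
    then show "\<exists>L. ((\<lambda>t. tail (F \<star> F) t / tail F t) \<longlongrightarrow> L) at_top" ..
  qed
  finally show ?thesis .
qed

text \<open>The \<open>2 * m\<close> summands are grouped into pairs, and each pair adds
  \<open>b\<close>. The bound for a pair has no shift, so only the remaining power carries an
  accumulated one.\<close>

lemma tail_bound_conv_power_even:
  assumes "real_distribution F" and "\<F> \<le> at_top" and "0 \<le> b"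
    and FF: "\<forall>\<^sub>F s in \<F>. b * tail F s \<le> tail (F \<star> F) s"
  shows "tail_bound_up_to_shift F \<F> (conv_power F (2 * m)) (real m * b)"
proof (induction m)
  case 0
  interpret F: real_distribution F by fact
  interpret Z: real_distribution "conv_power F 0" using assms by (intro real_distribution_conv_power)
  have "(real 0 * b - e) * tail F s \<le> tail (conv_power F (2 * 0)) (s - 0)" if "e > 0" for e s
  proof -
    have "(real 0 * b - e) * tail F s \<le> 0"
      using that F.tail_nonneg by (intro mult_nonpos_nonneg) auto
    also have "0 \<le> tail (conv_power F (2 * 0)) (s - 0)"
      using Z.tail_nonneg by (simp only: mult_0_right)
    finally show ?thesis .
  qed
  then show ?case
    unfolding tail_bound_up_to_shift_def by (intro allI impI exI[of _ 0] conjI always_eventually) auto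
next
  case (Suc m)
  interpret F: real_distribution F by fact
  interpret H: real_distribution "conv_power F (2 * m)" using assms by (intro real_distribution_conv_power)
  interpret FF: real_distribution_pair F F using assms by (simp add: real_distribution_pairI)
  have "conv_power F (2 * Suc m) = (F \<star> (F \<star> conv_power F (2 * m)))" by simp
  also have "\<dots> = ((F \<star> F) \<star> conv_power F (2 * m))"
    by (rule convolution_associative) (simp_all add: F.finite_measure_axioms H.finite_measure_axioms)
  finally show ?case
    using tail_bound_up_to_shift_convolution[OF assms(1) FF.real_distribution_convolution
        H.real_distribution_axioms assms(2) FF Suc] assms(3)
    by (simp add: distrib_right)
qed

text \<open>A failure for arbitrarily large \<open>s\<close> would accumulate over \<open>m\<close>
  pairs, and the tail of the even power would exceed its assumed bound.\<close>

lemma convolution_bound_from_even_powers: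
  assumes "real_distribution F" and lt: "long_tailed F" and "\<delta> > 0" and "m > 0"
    and bound: "\<And>s. s \<ge> t0 \<Longrightarrow> tail (conv_power F (2 * m)) s \<le> (1 + \<delta> / 8) * (real (2 * m) * tail F s)"
  shows "\<forall>\<^sub>F t in at_top. tail (F \<star> F) t \<le> (2 + \<delta>) * tail F t"
proof (rule ccontr)
  interpret F: real_distribution F by fact
  have pos: "tail F t > 0" for t using F.long_tailed_pos[OF lt] .
  \<comment> \<open>Restricting to the exceptional arguments turns a frequent failure into an
    eventual inequality, and the filter is proper exactly because the failure is frequent.\<close>
  define \<F> where "\<F> = inf at_top (principal {s. (2 + \<delta>) * tail F s \<le> tail (F \<star> F) s})"
  assume "\<not> ?thesis"
  then have "\<exists>\<^sub>F t in at_top. (2 + \<delta>) * tail F t < tail (F \<star> F) t"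
    by (simp add: frequently_def not_less)
  then have "\<exists>\<^sub>F t in at_top. t \<in> {s. (2 + \<delta>) * tail F s \<le> tail (F \<star> F) s}"
    by (rule frequently_elim1) simp
  then have "\<F> \<noteq> bot"
    by (simp add: \<F>_def trivial_limit_def eventually_inf_principal frequently_def)
  have top: "\<F> \<le> at_top" by (simp add: \<F>_def)
  have "tail_bound_up_to_shift F \<F> (conv_power F (2 * m)) (real m * (2 + \<delta>))"
    using assms(1,3) top by (intro tail_bound_conv_power_even) (auto simp: \<F>_def eventually_inf_principal)
  then obtain K where K: "\<forall>\<^sub>F s in \<F>. (real m * (2 + \<delta>) - real m * (\<delta> / 4)) * tail F s \<le> tail (conv_power F (2 * m)) (s - K)"
    using \<open>\<delta> > 0\<close> \<open>m > 0\<close> unfolding tail_bound_up_to_shift_def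
    by (elim allE[where x="real m * (\<delta> / 4)"]) auto
  have "((\<lambda>t. tail F (t + - K) / tail F t) \<longlongrightarrow> 1) at_top"
    using lt unfolding long_tailed_def by blast
  \<comment> \<open>The numerator matches the lower bound:
    \<open>2 * m * (1 + 3 * \<delta> / 8)\<close> equals
    \<open>m * (2 + \<delta>) - m * (\<delta> / 4)\<close>. The quotient exceeds 1, so long tails
    absorb the shift \<open>K\<close>.\<close>
  then have "\<forall>\<^sub>F s in at_top. tail F (s + - K) / tail F s < (1 + 3 * \<delta> / 8) / (1 + \<delta> / 8)"
    using \<open>\<delta> > 0\<close> by (intro order_tendstoD(2)) (auto simp: field_simps)
  then have "\<forall>\<^sub>F s in at_top. tail F (s + - K) / tail F s < (1 + 3 * \<delta> / 8) / (1 + \<delta> / 8) \<and> s \<ge> t0 + K"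
    using eventually_ge_at_top[of "t0 + K"] by eventually_elim simp
  then have "\<forall>\<^sub>F s in \<F>. tail F (s + - K) / tail F s < (1 + 3 * \<delta> / 8) / (1 + \<delta> / 8) \<and> s \<ge> t0 + K"
    by (rule filter_leD[OF top])
  with K have "\<forall>\<^sub>F s in \<F>. False"
  proof eventually_elim
    fix s assume s: "(real m * (2 + \<delta>) - real m * (\<delta> / 4)) * tail F s \<le> tail (conv_power F (2 * m)) (s - K)"
      "tail F (s + - K) / tail F s < (1 + 3 * \<delta> / 8) / (1 + \<delta> / 8) \<and> s \<ge> t0 + K"
    have "(1 + \<delta> / 8) * tail F (s - K) < (1 + 3 * \<delta> / 8) * tail F s"
      using s(2) pos[of s] \<open>\<delta> > 0\<close> by (simp add: divide_less_eq less_divide_eq mult_ac)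
    then have "real (2 * m) * ((1 + \<delta> / 8) * tail F (s - K)) < real (2 * m) * ((1 + 3 * \<delta> / 8) * tail F s)"
      using \<open>m > 0\<close> by simp
    also have "\<dots> = (real m * (2 + \<delta>) - real m * (\<delta> / 4)) * tail F s"
      by (simp add: algebra_simps)
    also have "\<dots> \<le> tail (conv_power F (2 * m)) (s - K)" by fact
    also have "\<dots> \<le> (1 + \<delta> / 8) * (real (2 * m) * tail F (s - K))"
      using s(2) by (intro bound) auto
    finally show False by (simp only: mult.left_commute less_irrefl)
  qed
  with \<open>\<F> \<noteq> bot\<close> show False by (simp add: trivial_limit_def)
qed

text \<open>For fixed \<open>n \<ge> 1\<close> the ratio tends to 1, so \<open>t n\<close> is a
  positive point from which on the error stays within \<open>1 / real n\<close>. For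
  \<open>n = 0\<close> nothing is required and 1 serves.\<close>

lemma subexponential_uniform_tail_conv_power:
  assumes "subexponential F"
  shows "\<exists>t :: nat \<Rightarrow> real. (\<forall>n. t n > 0) \<and>
    (\<forall>n\<ge>1. \<forall>s\<ge>t n. \<bar>tail (conv_power F n) s / (real n * tail F s) - 1\<bar> \<le> 1 / real n)"
proof -
  have F: "real_distribution F" "long_tailed F"
    using assms by (auto simp: subexponential_def long_tailed_def)
  have "\<exists>t>0. \<forall>s\<ge>t. n \<ge> 1 \<longrightarrow> \<bar>tail (conv_power F n) s / (real n * tail F s) - 1\<bar> \<le> 1 / real n" for n
  proof (cases "n \<ge> 1")
    case True
    have "((\<lambda>s. tail (conv_power F n) s / tail F s / real n) \<longlongrightarrow> real n / real n) at_top"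
      using True F assms long_tailed_subexponential_iff[OF F]
      by (intro tendsto_divide tendsto_const tail_conv_power_asymp) auto
    then have "\<forall>\<^sub>F s in at_top. dist (tail (conv_power F n) s / tail F s / real n) (real n / real n) < 1 / real n"
      using True by (intro tendstoD) auto
    then obtain t0 where "\<And>s. s \<ge> t0 \<Longrightarrow>
        dist (tail (conv_power F n) s / tail F s / real n) (real n / real n) < 1 / real n"
      by (auto simp: eventually_at_top_linorder)
    then have "\<bar>tail (conv_power F n) s / (real n * tail F s) - 1\<bar> \<le> 1 / real n" if "s \<ge> max 1 t0" for s
      using that True by (simp add: dist_real_def mult.commute less_imp_le)
    then show ?thesis by (intro exI[of _ "max 1 t0"]) auto
  qed (auto intro: exI[of _ 1])
  then show ?thesis by metis
qed

text \<open>For each \<open>\<delta>\<close>, a single even index with supremum below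
  \<open>1 + \<delta> / 8\<close> suffices for
  \<open>convolution_bound_from_even_powers\<close>.\<close>

lemma subexponential_if_limsup_le_1:
  assumes "real_distribution F" and lt: "long_tailed F"
    and lim: "limsup (\<lambda>n. SUP s\<in>{t n..}. ereal (tail (conv_power F n) s / (real n * tail F s))) \<le> 1"
  shows "subexponential F"
  unfolding long_tailed_subexponential_iff[OF assms(1,2)]
proof (intro allI impI)
  fix \<delta> :: real assume "\<delta> > 0"
  interpret F: real_distribution F by fact
  have pos: "tail F t > 0" for t using F.long_tailed_pos[OF lt] .
  have "(1::ereal) < ereal (1 + \<delta> / 8)" using \<open>\<delta> > 0\<close> by (simp add: one_ereal_def)
  with lim have "\<forall>\<^sub>F n in sequentially.
      (SUP s\<in>{t n..}. ereal (tail (conv_power F n) s / (real n * tail F s))) < ereal (1 + \<delta> / 8)"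
    by (intro Limsup_lessD) (rule le_less_trans)
  then obtain n0 where n0: "\<And>n. n \<ge> n0 \<Longrightarrow>
      (SUP s\<in>{t n..}. ereal (tail (conv_power F n) s / (real n * tail F s))) < ereal (1 + \<delta> / 8)"
    by (auto simp: eventually_sequentially)
  define m where "m = Suc n0"
  have "m > 0" "2 * m \<ge> n0" by (simp_all add: m_def)
  show "\<forall>\<^sub>F t in at_top. tail (F \<star> F) t \<le> (2 + \<delta>) * tail F t"
  proof (rule convolution_bound_from_even_powers[OF assms(1) lt \<open>\<delta> > 0\<close> \<open>m > 0\<close>])
    fix s assume "s \<ge> t (2 * m)"
    then have "ereal (tail (conv_power F (2 * m)) s / (real (2 * m) * tail F s)) < ereal (1 + \<delta> / 8)"
      by (intro le_less_trans[OF SUP_upper n0[OF \<open>2 * m \<ge> n0\<close>]]) simp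
    moreover have "0 < real (2 * m) * tail F s" using \<open>m > 0\<close> pos[of s] by simp
    ultimately show "tail (conv_power F (2 * m)) s \<le> (1 + \<delta> / 8) * (real (2 * m) * tail F s)"
      unfolding less_ereal.simps by (simp only: pos_divide_less_eq less_imp_le)
  qed
qed

lemma tendsto_ereal_add_inverse: "(\<lambda>n. ereal (a + 1 / real n)) \<longlonglongrightarrow> ereal a"
proof -
  have "(\<lambda>n. a + 1 / real n) \<longlonglongrightarrow> a + 0"
    by (intro tendsto_add tendsto_const lim_1_over_n)
  then show ?thesis by (simp add: lim_ereal)
qed

theorem theorem1p1:
  fixes F :: "real measure" and P :: "'a measure" and X :: "nat \<Rightarrow> 'a \<Rightarrow> real"
    and S :: "nat \<Rightarrow> 'a \<Rightarrow> real"
  assumes "real_distribution F"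
    and "prob_space P"
    and "prob_space.indep_vars P (\<lambda>_. borel) X {1..}"
    and "\<And>i. i \<ge> 1 \<Longrightarrow> distr P borel (X i) = F"
    and S_def: "\<And>n \<omega>. S n \<omega> = (\<Sum>i=1..n. X i \<omega>)"
  shows "(subexponential F \<longleftrightarrow>
           (\<forall>x::real. ((\<lambda>t. tail F (t + x) / tail F t) \<longlongrightarrow> 1) at_top) \<and>
           (\<exists>t :: nat \<Rightarrow> real. (\<forall>n. t n > 0) \<and>
              limsup (\<lambda>n. SUP s\<in>{t n..}. ereal (\<P>(\<omega> in P. S n \<omega> > s) / (real n * tail F s))) \<le> 1)) \<and>
         (subexponential F \<longrightarrow>
           (\<exists>t :: nat \<Rightarrow> real. (\<forall>n. t n > 0) \<and>
              (\<lambda>n. SUP s\<in>{t n..}. ereal \<bar>\<P>(\<omega> in P. S n \<omega> > s) / (real n * tail F s) - 1\<bar>)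
                \<longlonglongrightarrow> 0))"
proof -
  interpret P: prob_space P by fact
  have rv: "X i \<in> borel_measurable P" if "i \<ge> 1" for i
    using assms(3) that by (auto simp: P.indep_vars_def)
  \<comment> \<open>Every probability about \<open>S n\<close> becomes a tail of
    \<open>conv_power F n\<close>, so the rest concerns \<open>F\<close> alone.\<close>
  have prob: "\<P>(\<omega> in P. S n \<omega> > s) = tail (conv_power F n) s" for n s
  proof -
    interpret C: real_distribution "conv_power F n" by (rule real_distribution_conv_power) fact
    have S: "S n = (\<lambda>\<omega>. \<Sum>i=1..n. X i \<omega>)" using S_def by blast
    have meas: "S n \<in> borel_measurable P" unfolding S by (intro borel_measurable_sum rv) simp
    have law: "conv_power F n = distr P borel (S n)"
      unfolding S by (rule distr_sum_eq_conv_power[symmetric]) fact+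
    have "tail (conv_power F n) s = measure (distr P borel (S n)) {s<..}"
      using C.tail_eq_measure[of s] law by simp
    also have "\<dots> = \<P>(\<omega> in P. S n \<omega> > s)"
      by (subst measure_distr[OF meas]) (auto intro!: arg_cong[where f="measure P"])
    finally show ?thesis ..
  qed
  \<comment> \<open>One sequence \<open>t\<close> serves both the limsup bound and the uniform
    convergence.\<close>
  have uniform: "\<exists>t :: nat \<Rightarrow> real. (\<forall>n. t n > 0) \<and>
      limsup (\<lambda>n. SUP s\<in>{t n..}. ereal (tail (conv_power F n) s / (real n * tail F s))) \<le> 1 \<and>
      (\<lambda>n. SUP s\<in>{t n..}. ereal \<bar>tail (conv_power F n) s / (real n * tail F s) - 1\<bar>) \<longlonglongrightarrow> 0"
    if sub: "subexponential F"
  proof -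
    obtain t :: "nat \<Rightarrow> real" where t: "\<And>n. t n > 0"
      and bd: "\<And>n s. n \<ge> 1 \<Longrightarrow> s \<ge> t n \<Longrightarrow>
        \<bar>tail (conv_power F n) s / (real n * tail F s) - 1\<bar> \<le> 1 / real n"
      using subexponential_uniform_tail_conv_power[OF sub] by blast
    have "\<forall>\<^sub>F n in sequentially. (SUP s\<in>{t n..}. ereal (tail (conv_power F n) s / (real n * tail F s)))
        \<le> ereal (1 + 1 / real n)"
      using eventually_ge_at_top[of 1]
    proof eventually_elim
      case (elim n)
      have "tail (conv_power F n) s / (real n * tail F s) \<le> 1 + 1 / real n" if "s \<ge> t n" for s
        using bd[OF elim that] by linarith
      then show ?case by (intro SUP_least) simp
    qed
    then have "limsup (\<lambda>n. SUP s\<in>{t n..}. ereal (tail (conv_power F n) s / (real n * tail F s)))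
        \<le> limsup (\<lambda>n. ereal (1 + 1 / real n))"
      by (rule Limsup_mono)
    also have "\<dots> = ereal 1"
      by (rule lim_imp_Limsup[OF sequentially_bot tendsto_ereal_add_inverse])
    finally have 1: "limsup (\<lambda>n. SUP s\<in>{t n..}. ereal (tail (conv_power F n) s / (real n * tail F s))) \<le> 1"
      by (simp only: one_ereal_def)
    have up: "\<forall>\<^sub>F n in sequentially. (SUP s\<in>{t n..}. ereal \<bar>tail (conv_power F n) s / (real n * tail F s) - 1\<bar>)
        \<le> ereal (0 + 1 / real n)"
      using eventually_ge_at_top[of 1]
      by eventually_elim (use bd in \<open>auto intro!: SUP_least\<close>)
    \<comment> \<open>The point \<open>t n\<close> belongs to the index set; over an empty set the
      supremum in \<open>ereal\<close> would be negative infinity.\<close>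
    have low: "ereal 0 \<le> (SUP s\<in>{t n..}. ereal \<bar>tail (conv_power F n) s / (real n * tail F s) - 1\<bar>)" for n
      by (rule SUP_upper2[of "t n"]) auto
    have "(\<lambda>n. SUP s\<in>{t n..}. ereal \<bar>tail (conv_power F n) s / (real n * tail F s) - 1\<bar>) \<longlonglongrightarrow> ereal 0"
      by (rule tendsto_sandwich[OF always_eventually up tendsto_const tendsto_ereal_add_inverse])
        (use low in blast)
    then have 2: "(\<lambda>n. SUP s\<in>{t n..}. ereal \<bar>tail (conv_power F n) s / (real n * tail F s) - 1\<bar>) \<longlonglongrightarrow> 0"
      by (simp only: zero_ereal_def)
    from t 1 2 show ?thesis by blast
  qed
  have lt: "subexponential F \<Longrightarrow> long_tailed F"
    by (simp add: subexponential_def long_tailed_def)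
  show ?thesis
    unfolding prob long_tailed_def[symmetric]
    using uniform lt subexponential_if_limsup_le_1[OF assms(1)] by blast
qed

end
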